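(* Let $\{\lambda_n\}_{n\ge 0}\subset\mathbb{C}$ be a sequence with $\lambda_0=0$, and let $P_n(x)=\sum_{i=0}^n b_{n,i}x^i$ with $b_{n,n}=1$, $n=0,1,2,\ldots$, be a sequence of monic polynomials with complex coefficients. Define the numbers $\delta_n^{(k)}$, $n\ge 0$, $0\le k\le n$, from $\{\lambda_n\}$ and $\{P_n\}$ by $\delta_n^{(0)}=\lambda_n$ and, for $1\le k\le n$, by the determinant formula given in the context. Then for all $n\in\mathbb{N}$ $$\sum_{k=0}^{n-m}\delta_{m+k}^{(k)}\,b_{n,m+k}=\lambda_n b_{n,m},\qquad m=0,1,\ldots,n .$$
   Context: For $n\ge 1$ and $1\le k\le n$, $$\delta_n^{(k)}=(-1)^k\det\bigl(d_{r,c}\bigr)_{1\le r,c\le k},$$ where the first row is $d_{1,c}=(\lambda_{n-k}-\lambda_{n-k+c})\,b_{n-k+c,\,n-k}$ for $1\le c\le k$, and for $2\le r\le k$ the entries are $d_{r,c}=b_{n-k+c,\,n-k+r-1}$, with the convention $b_{i,j}=0$ if $j>i$. Thus $d_{r,r-1}=1$ and $d_{r,c}=0$ for $c<r-1$; explicitly, $$\delta_n^{(k)}=(-1)^k\left|\begin{array}{cccc}(\lambda_{n-k}-\lambda_{n-k+1})b_{n-k+1,n-k}&(\lambda_{n-k}-\lambda_{n-k+2})b_{n-k+2,n-k}&\cdots&(\lambda_{n-k}-\lambda_{n})b_{n,n-k}\\ 1&b_{n-k+2,n-k+1}&\cdots&b_{n,n-k+1}\\ 0&1&\cdots&b_{n,n-k+2}\\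 \vdots&\ddots&\ddots&\vdots\\ 0&\cdots&1&b_{n,n-1}\end{array}\right|.$$ *)

theory Defs
  imports Complex_Main "HOL-Computational_Algebra.Polynomial" "Jordan_Normal_Form.Determinant"
begin

(* The number b_{n,i} is Polynomial.coeff (P n) i.  When degree (P n) = n, the convention
   b_{i,j} = 0 for j > i holds automatically.  Row and column indices r, c start at 1. *)

definition delta_entry ::
  "(nat \<Rightarrow> complex) \<Rightarrow> (nat \<Rightarrow> complex poly) \<Rightarrow> nat \<Rightarrow> nat \<Rightarrow> nat \<Rightarrow> nat \<Rightarrow> complex" where
  "delta_entry lam P n k r c =
     (if r = 1
      then (lam (n - k) - lam (n - k + c)) * Polynomial.coeff (P (n - k + c)) (n - k)
      else Polynomial.coeff (P (n - k + c)) (n - k + r - 1))"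

(* delta lam P n k is delta_n^(k); it is meaningful for k \<le> n only (n - k truncates).
   Matrices are indexed from 0, hence the shifts by 1. *)

definition delta ::
  "(nat \<Rightarrow> complex) \<Rightarrow> (nat \<Rightarrow> complex poly) \<Rightarrow> nat \<Rightarrow> nat \<Rightarrow> complex" where
  "delta lam P n k =
     (if k = 0 then lam n
      else (- 1) ^ k *
        Determinant.det (Matrix.mat k k (\<lambda>(i, j). delta_entry lam P n k (i + 1) (j + 1))))"

end

theory Submission
  imports Defs
begin

text \<open>
  Fix \<open>m\<close>. The matrices whose determinants give \<open>\<delta>\<^bsub>m+k\<^esub>\<^sup>(\<^sup>k\<^sup>)\<close> for \<open>k = 1, 2, \<dots>\<close> are then nested:
  the entries depend on \<open>m\<close> alone, so each matrix is a leading principal block of the next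
  (\<open>delta_add_eq_det\<close>). They are also upper Hessenberg with ones on the subdiagonal, so expanding along
  the last column expresses each determinant through all the smaller ones (\<open>det_hessenberg\<close>). With
  the factor \<open>(-1)\<^sup>k\<close> absorbed, all the signs agree and the expansion reads
  \[ \sum_{k=1}^{j} \delta_{m+k}^{(k)} b_{m+j,m+k} = (\lambda_{m+j} - \lambda_m) b_{m+j,m}, \]
  where the term \<open>k = j\<close> comes from \<open>b\<^bsub>m+j,m+j\<^esub> = 1\<close>. Adding the term
  \<open>\<delta>\<^sub>m\<^sup>(\<^sup>0\<^sup>) b\<^bsub>m+j,m\<^esub> = \<lambda>\<^sub>m b\<^bsub>m+j,m\<^esub>\<close> gives the claim for \<open>n = m + j\<close>.
\<close>

text \<open>
  Deleting row \<open>r\<close> and the last column leaves a block upper triangular matrix: the leading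
  principal block of size \<open>r\<close>, and below it an upper triangular block whose diagonal consists
  of the subdiagonal entries of the original matrix from column \<open>r\<close> on.
\<close>

lemma det_hessenberg_minor:
  fixes f :: "nat \<Rightarrow> nat \<Rightarrow> 'a :: idom"
  assumes hess: "\<And>i j. Suc j < i \<Longrightarrow> f i j = 0" and "r \<le> n"
  shows "det (mat_delete (mat (Suc n) (Suc n) (\<lambda>(i, j). f i j)) r n) =
    det (mat r r (\<lambda>(i, j). f i j)) * (\<Prod>i = r..<n. f (Suc i) i)"
proof -
  let ?A = "mat r r (\<lambda>(i, j). f i j)"
  let ?B = "mat r (n - r) (\<lambda>(i, j). f i (r + j))"
  let ?C = "mat (n - r) (n - r) (\<lambda>(i, j). f (Suc (r + i)) (r + j))"
  have "mat_delete (mat (Suc n) (Suc n) (\<lambda>(i, j). f i j)) r n =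
      four_block_mat ?A ?B (0\<^sub>m (n - r) r) ?C"
    using \<open>r \<le> n\<close> by (intro eq_matI) (auto simp: mat_delete_def intro: hess)
  then have "det (mat_delete (mat (Suc n) (Suc n) (\<lambda>(i, j). f i j)) r n) = det ?A * det ?C"
    by (simp add: det_four_block_mat_lower_left_zero[where n = r and m = "n - r"])
  also have "det ?C = prod_list (diag_mat ?C)"
    by (rule det_upper_triangular[where n = "n - r"]) (auto simp: upper_triangular_def intro: hess)
  also have "\<dots> = (\<Prod>i = 0..<n - r. f (Suc (r + i)) (r + i))"
    by (simp add: prod_list_diag_prod)
  also have "\<dots> = (\<Prod>i = r..<n. f (Suc i) i)"
    using prod.shift_bounds_nat_ivl[of "\<lambda>i. f (Suc i) i" 0 r "n - r"] \<open>r \<le> n\<close>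
    by (simp add: add.commute)
  finally show ?thesis .
qed

lemma det_hessenberg:
  fixes f :: "nat \<Rightarrow> nat \<Rightarrow> 'a :: idom"
  assumes hess: "\<And>i j. Suc j < i \<Longrightarrow> f i j = 0"
  shows "det (mat (Suc n) (Suc n) (\<lambda>(i, j). f i j)) =
    (\<Sum>r\<le>n. (- 1) ^ (r + n) * f r n * det (mat r r (\<lambda>(i, j). f i j)) * (\<Prod>i = r..<n. f (Suc i) i))"
proof -
  let ?M = "mat (Suc n) (Suc n) (\<lambda>(i, j). f i j)"
  have "det ?M = (\<Sum>r<Suc n. ?M $$ (r, n) * cofactor ?M r n)"
    by (rule laplace_expansion_column) auto
  also have "\<dots> = (\<Sum>r\<le>n. (- 1) ^ (r + n) * f r n * det (mat r r (\<lambda>(i, j). f i j)) *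
      (\<Prod>i = r..<n. f (Suc i) i))"
    by (rule sum.cong) (auto simp: cofactor_def det_hessenberg_minor[OF hess])
  finally show ?thesis .
qed

text \<open>
  As a function of row and column, an entry of the matrix for \<open>\<delta>\<^sub>n\<^sup>(\<^sup>k\<^sup>)\<close> involves \<open>n\<close> and \<open>k\<close> only
  through \<open>m = n - k\<close>; hence the parameters \<open>m\<close> and \<open>0\<close> of \<open>delta_entry\<close> on the right, where
  \<open>k\<close> remains only as the size of the matrix and in the sign. For \<open>k = 0\<close> the equation fails:
  there \<open>delta\<close> is \<open>\<lambda>\<^sub>m\<close>, while the empty determinant is \<open>1\<close>.
\<close>

lemma delta_add_eq_det:
  assumes "k > 0"
  shows "delta lam P (m + k) k =
    (- 1) ^ k * det (mat k k (\<lambda>(i, j). delta_entry lam P m 0 (Suc i) (Suc j)))"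
proof -
  have "delta_entry lam P (m + k) k = delta_entry lam P m 0"
    by (intro ext) (simp add: delta_entry_def)
  then show ?thesis
    using assms by (simp add: delta_def)
qed

text \<open>
  Count rows from \<open>0\<close>. The contribution of row \<open>0\<close> to the expansion carries the empty
  determinant, so it is the inhomogeneous term; the contribution of row \<open>k \<ge> 1\<close> is a multiple of \<open>\<delta>\<^bsub>m+k\<^esub>\<^sup>(\<^sup>k\<^sup>)\<close>.
\<close>

lemma delta_recurrence:
  assumes deg: "\<And>n. degree (P n) = n"
    and monic: "\<And>n. Polynomial.coeff (P n) n = 1"
  shows "(\<Sum>k = 1..Suc j. delta lam P (m + k) k * Polynomial.coeff (P (m + Suc j)) (m + k)) =
    (lam (m + Suc j) - lam m) * Polynomial.coeff (P (m + Suc j)) m"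
proof -
  define f where "f = (\<lambda>i j. delta_entry lam P m 0 (Suc i) (Suc j))"
  define D where "D = (\<lambda>k. det (mat k k (\<lambda>(i, j). f i j)))"
  let ?b = "\<lambda>k. Polynomial.coeff (P (m + Suc j)) (m + k)"
  have f_0: "f 0 j = (lam m - lam (m + Suc j)) * ?b 0"
    by (simp add: f_def delta_entry_def)
  have f_pos: "f k j = ?b k" if "k > 0" for k
    using that by (simp add: f_def delta_entry_def)
  have sub: "f (Suc i) i = 1" for i
    using monic[of "Suc (m + i)"] by (simp add: f_def delta_entry_def)
  have hess: "f i l = 0" if "Suc l < i" for i l
    using that deg by (auto simp: f_def delta_entry_def intro!: coeff_eq_0)
  have delta: "delta lam P (m + k) k = (- 1) ^ k * D k" if "k > 0" for k
    using delta_add_eq_det[OF that] by (simp add: D_def f_def)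
  have "D (Suc j) = (\<Sum>r\<le>j. (- 1) ^ (r + j) * f r j * D r)"
    unfolding D_def by (subst det_hessenberg) (auto simp: hess sub)
  also have "\<dots> = (- 1) ^ j * f 0 j + (\<Sum>r = 1..j. (- 1) ^ (r + j) * f r j * D r)"
    by (simp add: D_def sum.atMost_shift sum.atLeast1_atMost_eq)
  also have "(\<Sum>r = 1..j. (- 1) ^ (r + j) * f r j * D r) =
      (- 1) ^ j * (\<Sum>k = 1..j. delta lam P (m + k) k * ?b k)"
    by (auto simp: sum_distrib_left delta f_pos power_add intro!: sum.cong)
  finally have "delta lam P (m + Suc j) (Suc j) =
      - f 0 j - (\<Sum>k = 1..j. delta lam P (m + k) k * ?b k)"
    by (subst delta) (auto simp: algebra_simps simp flip: power_add mult_2)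
  then show ?thesis
    using monic[of "m + Suc j"] by (simp add: f_0 algebra_simps)
qed

theorem theorem5:
  fixes lam :: "nat \<Rightarrow> complex" and P :: "nat \<Rightarrow> complex poly"
  assumes lam0: "lam 0 = 0"
    and deg: "\<And>n. degree (P n) = n"
    and monic: "\<And>n. Polynomial.coeff (P n) n = 1"
  shows "\<forall>n. \<forall>m\<le>n.
    (\<Sum>k = 0..n - m. delta lam P (m + k) k * Polynomial.coeff (P n) (m + k))
      = lam n * Polynomial.coeff (P n) m"
proof (intro allI impI)
  fix n m :: nat
  assume "m \<le> n"
  then obtain j where n: "n = m + j"
    using le_Suc_ex by blast
  have "(\<Sum>k = 0..n - m. delta lam P (m + k) k * Polynomial.coeff (P n) (m + k)) =
      lam m * Polynomial.coeff (P n) m +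
      (\<Sum>k = 1..j. delta lam P (m + k) k * Polynomial.coeff (P n) (m + k))"
    by (simp add: n sum.atLeast_Suc_atMost delta_def)
  also have "\<dots> = lam n * Polynomial.coeff (P n) m"
  proof (cases j)
    case 0
    then show ?thesis by (simp add: n)
  next
    case (Suc i)
    then show ?thesis
      using delta_recurrence[OF deg monic, where j = i and m = m and lam = lam]
      by (simp add: n algebra_simps)
  qed
  finally show "(\<Sum>k = 0..n - m. delta lam P (m + k) k * Polynomial.coeff (P n) (m + k))
      = lam n * Polynomial.coeff (P n) m" .
qed

end
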